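(* For every permutation $\pi$ of rank $n$, \[\mathbf{1}\cdot\pi=\mathbf{1}\cdot\mathbf{1}^{\mathrm{c}}+\operatorname{ninvsum}(\pi).\]
   Context: For a permutation $\pi$ of rank $n$ (a bijection of $\{1,\dots,n\}$), $\mathbf{1}\cdot\pi=\sum_{i=1}^n i\,\pi(i)$, where $\mathbf{1}=12\cdots n$ is the identity permutation of rank $n$. The complement of $\pi$ is $\pi^{\mathrm{c}}=(n+1-\pi_1)(n+1-\pi_2)\cdots(n+1-\pi_n)$, so $\mathbf{1}^{\mathrm{c}}=n(n-1)\cdots 1$. A non-inversion of $\pi$ is a pair $(a,b)$ with $1\le a<b\le n$ and $\pi(a)<\pi(b)$; $\mathrm{NINV}(\pi)$ is the set of non-inversions, and $\operatorname{ninvsum}(\pi)=\sum_{(a,b)\in\mathrm{NINV}(\pi)}(b-a)$. *)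

theory Defs
  imports "HOL-Combinatorics.Permutations"
begin

text \<open>
  A permutation of rank \<open>n\<close> is a function \<open>\<pi>\<close> with \<open>\<pi> permutes {1..n}\<close>; outside \<open>{1..n}\<close> it is the
  identity by convention. In particular \<open>id\<close> is the identity permutation of every rank.
\<close>

definition perm_dot :: "nat \<Rightarrow> (nat \<Rightarrow> nat) \<Rightarrow> (nat \<Rightarrow> nat) \<Rightarrow> nat" where
  "perm_dot n \<sigma> \<pi> = (\<Sum>i = 1..n. \<sigma> i * \<pi> i)"

text \<open>The subtraction on \<open>nat\<close> is exact, since \<open>\<pi> i \<le> n\<close> for \<open>i \<in> {1..n}\<close>.\<close>

definition perm_complement :: "nat \<Rightarrow> (nat \<Rightarrow> nat) \<Rightarrow> nat \<Rightarrow> nat" where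
  "perm_complement n \<pi> = (\<lambda>i. if i \<in> {1..n} then n + 1 - \<pi> i else i)"

lemma perm_complement_permutes:
  assumes "\<pi> permutes {1..n}"
  shows "perm_complement n \<pi> permutes {1..n}"
proof (rule bij_imp_permutes)
  have "bij_betw \<pi> {1..n} {1..n}"
    using assms by (rule permutes_imp_bij)
  moreover have "bij_betw (\<lambda>k. n + 1 - k) {1..n} {1..n}"
    by (rule bij_betwI[where g = "\<lambda>k. n + 1 - k"]) auto
  ultimately have "bij_betw ((\<lambda>k. n + 1 - k) \<circ> \<pi>) {1..n} {1..n}"
    by (rule bij_betw_trans)
  then show "bij_betw (perm_complement n \<pi>) {1..n} {1..n}"
    by (rule bij_betw_cong[THEN iffD1, rotated]) (simp add: perm_complement_def)
qed (auto simp: perm_complement_def)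

definition NINV :: "nat \<Rightarrow> (nat \<Rightarrow> nat) \<Rightarrow> (nat \<times> nat) set" where
  "NINV n \<pi> = {(a, b). 1 \<le> a \<and> a < b \<and> b \<le> n \<and> \<pi> a < \<pi> b}"

lemma finite_NINV: "finite (NINV n \<pi>)"
  by (rule finite_subset[of _ "{1..n} \<times> {1..n}"]) (auto simp: NINV_def)

definition ninvsum :: "nat \<Rightarrow> (nat \<Rightarrow> nat) \<Rightarrow> nat" where
  "ninvsum n \<pi> = (\<Sum>(a, b) \<in> NINV n \<pi>. b - a)"

end

theory Submission
  imports Defs
begin

text \<open>
  Since \<open>\<pi> b - 1\<close> counts the \<open>a\<close> with \<open>\<pi> a < \<pi> b\<close>, the dot product \<open>\<Sum>b. b * \<pi> b\<close> is \<open>\<Sum>b. b\<close> plus the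
  sum of \<open>b\<close> over all pairs with \<open>\<pi> a < \<pi> b\<close>. Every pair of positions contributes the larger position
  if it is a non-inversion and the smaller one otherwise, so compared with the reversed permutation,
  where it always contributes the smaller one, a non-inversion \<open>(a, b)\<close> adds \<open>b - a\<close>.
\<close>

text \<open>The positions counted are mapped by \<pi> bijectively onto the values 1, ...,
  \<open>\<pi> b - 1\<close>.\<close>

lemma card_permutes_less:
  assumes "\<pi> permutes {1..n}" and "b \<in> {1..n}"
  shows "card {a \<in> {1..n}. \<pi> a < \<pi> b} = \<pi> b - 1"
proof -
  have "\<pi> ` {a \<in> {1..n}. \<pi> a < \<pi> b} = {k \<in> \<pi> ` {1..n}. k < \<pi> b}"
    by auto
  also have "\<dots> = {1..<\<pi> b}"
    using permutes_image[OF assms(1)] permutes_in_image[OF assms(1), of b] assms(2) by auto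
  finally have "card (\<pi> ` {a \<in> {1..n}. \<pi> a < \<pi> b}) = \<pi> b - 1"
    by simp
  moreover have "inj_on \<pi> {a \<in> {1..n}. \<pi> a < \<pi> b}"
    using permutes_inj_on[OF assms(1)] .
  ultimately show ?thesis
    by (simp add: card_image)
qed

lemma perm_dot_id_conv_sum_pairs:
  assumes "\<pi> permutes {1..n}"
  shows "perm_dot n id \<pi> =
    \<Sum>{1..n} + (\<Sum>(a, b) \<in> {(a, b). a \<in> {1..n} \<and> b \<in> {1..n} \<and> \<pi> a < \<pi> b}. b)"
proof -
  have "(\<Sum>(a, b) \<in> {(a, b). a \<in> {1..n} \<and> b \<in> {1..n} \<and> \<pi> a < \<pi> b}. b) =
      (\<Sum>(b, a) \<in> (SIGMA b:{1..n}. {a \<in> {1..n}. \<pi> a < \<pi> b}). b)"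
    \<comment> \<open>Swapping the components fibres the pairs over \<open>b\<close>, so that the
      inner sum of the constant \<open>b\<close> becomes a cardinality.\<close>
    by (rule sum.reindex_bij_witness[of _ prod.swap prod.swap]) auto
  also have "\<dots> = (\<Sum>b\<in>{1..n}. \<Sum>a\<in>{a \<in> {1..n}. \<pi> a < \<pi> b}. b)"
    by (rule sum.Sigma[symmetric]) auto
  also have "\<dots> = (\<Sum>b\<in>{1..n}. b * (\<pi> b - 1))"
    using card_permutes_less[OF assms] by (intro sum.cong) auto
  finally have "\<Sum>{1..n} + (\<Sum>(a, b) \<in> {(a, b). a \<in> {1..n} \<and> b \<in> {1..n} \<and> \<pi> a < \<pi> b}. b) =
      (\<Sum>b\<in>{1..n}. b + b * (\<pi> b - 1))"
    by (simp add: sum.distrib)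
  also have "\<dots> = (\<Sum>b\<in>{1..n}. b * \<pi> b)"
  proof (rule sum.cong)
    fix b assume "b \<in> {1..n}"
    \<comment> \<open>Positivity makes the truncated subtraction in \<open>\<pi> b - 1\<close>
      exact.\<close>
    then have "\<pi> b \<ge> 1"
      using permutes_in_image[OF assms, of b] by auto
    then show "b + b * (\<pi> b - 1) = b * \<pi> b"
      by (cases "\<pi> b") auto
  qed simp
  finally show ?thesis
    by (simp add: perm_dot_def)
qed

text \<open>The reversed permutation has the value 1 + (n - a) at position \<open>a\<close>, and
  \<open>a\<close> is the smaller position in exactly n - a pairs.\<close>

lemma perm_dot_id_complement_conv_sum_pairs:
  "perm_dot n id (perm_complement n id) =
    \<Sum>{1..n} + (\<Sum>(a, b) \<in> {(a, b). 1 \<le> a \<and> a < b \<and> b \<le> n}. a)"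
proof -
  have "{(a, b). 1 \<le> a \<and> a < b \<and> b \<le> n} = (SIGMA a:{1..n}. {a<..n})"
    by auto
  then have "(\<Sum>(a, b) \<in> {(a, b). 1 \<le> a \<and> a < b \<and> b \<le> n}. a) = (\<Sum>a\<in>{1..n}. \<Sum>b\<in>{a<..n}. a)"
    by (simp only:) (rule sum.Sigma[symmetric]; simp)
  then have "\<Sum>{1..n} + (\<Sum>(a, b) \<in> {(a, b). 1 \<le> a \<and> a < b \<and> b \<le> n}. a) =
      (\<Sum>a\<in>{1..n}. a + (n - a) * a)"
    by (simp add: sum.distrib)
  also have "\<dots> = perm_dot n id (perm_complement n id)"
    unfolding perm_dot_def
    by (rule sum.cong) (auto simp: perm_complement_def Suc_diff_le)
  finally show ?thesis ..
qed

text \<open>The left sum orients each pair by value, the right one by position. The orientations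
  agree on non-inversions and are opposite on inversions.\<close>

lemma sum_snd_less_pairs:
  assumes "\<pi> permutes {1..n}"
  shows "(\<Sum>(a, b) \<in> {(a, b). a \<in> {1..n} \<and> b \<in> {1..n} \<and> \<pi> a < \<pi> b}. b) =
    (\<Sum>(a, b) \<in> {(a, b). 1 \<le> a \<and> a < b \<and> b \<le> n}. a) + ninvsum n \<pi>"
    (is "sum _ ?P = sum _ ?U + _")
proof -
  define INV where "INV = {(a, b). 1 \<le> a \<and> a < b \<and> b \<le> n \<and> \<pi> b < \<pi> a}"
  have fin: "finite INV"
    by (rule finite_subset[of _ "{1..n} \<times> {1..n}"]) (auto simp: INV_def)
  have P: "?P = NINV n \<pi> \<union> prod.swap ` INV"
  proof (rule set_eqI, clarify)
    fix a b
    show "(a, b) \<in> ?P \<longleftrightarrow> (a, b) \<in> NINV n \<pi> \<union> prod.swap ` INV"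
      by (cases a b rule: linorder_cases) (auto simp: NINV_def INV_def image_iff)
  qed
  \<comment> \<open>Injectivity rules out ties, so every pair of positions is an inversion or a
    non-inversion.\<close>
  have "\<pi> a < \<pi> b \<or> \<pi> b < \<pi> a" if "a < b" for a b
    using permutes_inj[OF assms] that by (metis injD nat_neq_iff)
  then have U: "?U = NINV n \<pi> \<union> INV"
    by (auto simp: NINV_def INV_def)
  have "(\<Sum>(a, b) \<in> ?P. b) = (\<Sum>(a, b) \<in> NINV n \<pi>. b) + (\<Sum>(a, b) \<in> prod.swap ` INV. b)"
    unfolding P
    by (intro sum.union_disjoint finite_NINV finite_imageI fin) (auto simp: NINV_def INV_def)
  \<comment> \<open>After the swap, an inversion has its smaller position second.\<close>
  also have "(\<Sum>(a, b) \<in> prod.swap ` INV. b) = (\<Sum>(a, b) \<in> INV. a)"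
    by (subst sum.reindex) (auto intro!: sum.cong)
  also have "(\<Sum>(a, b) \<in> NINV n \<pi>. b) = (\<Sum>(a, b) \<in> NINV n \<pi>. a + (b - a))"
    by (rule sum.cong) (auto simp: NINV_def)
  also have "\<dots> = (\<Sum>(a, b) \<in> NINV n \<pi>. a) + ninvsum n \<pi>"
    by (simp add: ninvsum_def sum.distrib case_prod_unfold)
  also have "\<dots> + (\<Sum>(a, b) \<in> INV. a) =
      (\<Sum>(a, b) \<in> NINV n \<pi>. a) + (\<Sum>(a, b) \<in> INV. a) + ninvsum n \<pi>"
    by simp
  also have "(\<Sum>(a, b) \<in> NINV n \<pi>. a) + (\<Sum>(a, b) \<in> INV. a) = (\<Sum>(a, b) \<in> ?U. a)"
    unfolding U
    by (intro sum.union_disjoint[symmetric] finite_NINV fin) (auto simp: NINV_def INV_def)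
  finally show ?thesis .
qed

theorem theorem2p5:
  fixes n :: nat and \<pi> :: "nat \<Rightarrow> nat"
  assumes "\<pi> permutes {1..n}"
  shows "perm_dot n id \<pi> = perm_dot n id (perm_complement n id) + ninvsum n \<pi>"
  unfolding perm_dot_id_conv_sum_pairs[OF assms] sum_snd_less_pairs[OF assms]
    perm_dot_id_complement_conv_sum_pairs
  by (rule add.assoc[symmetric])

end
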